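(* Let $S$ be a completely regular semigroup and let $\mu$ be the greatest idempotent separating congruence on $S$. If $\mu$ is orthodox, then $\ker\mu$ is cryptic.
   Context: A completely regular semigroup is a semigroup that is a union of its subgroups. $E(S)$ is the set of idempotents of $S$. A congruence is idempotent separating if any two idempotents related by it are equal. A regular semigroup is orthodox if its idempotents form a subsemigroup; a congruence $\rho$ on $S$ is orthodox if $S/\rho$ is orthodox. For a congruence $\rho$ on $S$, $\ker\rho=\{a\in S: a\,\rho\,e\text{ for some }e\in E(S)\}$; when $\rho$ is orthodox, $\ker\rho$ is a completely regular subsemigroup of $S$. A semigroup is cryptic if its Green's relation $\mathcal{H}$ is a congruence on it. *)

theory Defs
  imports "HOL-Algebra.Group"
begin

text \<open>
  Semigroups are given by a carrier \<open>S\<close> and a binary operation \<open>f\<close> that matters only on \<open>S\<close>,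
  since subsemigroups and quotients of a semigroup have to be semigroups of the same kind.
  The empty semigroup is admitted.
\<close>

definition semigroup_on :: "'a set \<Rightarrow> ('a \<Rightarrow> 'a \<Rightarrow> 'a) \<Rightarrow> bool" where
  "semigroup_on S f \<longleftrightarrow>
     (\<forall>a\<in>S. \<forall>b\<in>S. f a b \<in> S) \<and>
     (\<forall>a\<in>S. \<forall>b\<in>S. \<forall>c\<in>S. f (f a b) c = f a (f b c))"

text \<open>
  A subgroup may have any idempotent of \<open>S\<close> as its identity, hence the existential quantifier.
\<close>

definition subgroup_of :: "'a set \<Rightarrow> 'a set \<Rightarrow> ('a \<Rightarrow> 'a \<Rightarrow> 'a) \<Rightarrow> bool" where
  "subgroup_of G S f \<longleftrightarrow>
     G \<subseteq> S \<and> (\<exists>e. Group.group \<lparr>carrier = G, monoid.mult = f, one = e\<rparr>)"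

definition completely_regular :: "'a set \<Rightarrow> ('a \<Rightarrow> 'a \<Rightarrow> 'a) \<Rightarrow> bool" where
  "completely_regular S f \<longleftrightarrow> semigroup_on S f \<and> S = \<Union>{G. subgroup_of G S f}"

definition idempotents :: "'a set \<Rightarrow> ('a \<Rightarrow> 'a \<Rightarrow> 'a) \<Rightarrow> 'a set" where
  "idempotents S f = {e \<in> S. f e e = e}"

definition regular_semigroup :: "'a set \<Rightarrow> ('a \<Rightarrow> 'a \<Rightarrow> 'a) \<Rightarrow> bool" where
  "regular_semigroup S f \<longleftrightarrow> semigroup_on S f \<and> (\<forall>a\<in>S. \<exists>x\<in>S. f (f a x) a = a)"

definition orthodox_semigroup :: "'a set \<Rightarrow> ('a \<Rightarrow> 'a \<Rightarrow> 'a) \<Rightarrow> bool" where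
  "orthodox_semigroup S f \<longleftrightarrow>
     regular_semigroup S f \<and>
     (\<forall>d\<in>idempotents S f. \<forall>e\<in>idempotents S f. f d e \<in> idempotents S f)"

definition congruence_on :: "'a set \<Rightarrow> ('a \<Rightarrow> 'a \<Rightarrow> 'a) \<Rightarrow> ('a \<times> 'a) set \<Rightarrow> bool" where
  "congruence_on S f \<rho> \<longleftrightarrow>
     equiv S \<rho> \<and>
     (\<forall>a b c. (a, b) \<in> \<rho> \<longrightarrow> c \<in> S \<longrightarrow> (f c a, f c b) \<in> \<rho> \<and> (f a c, f b c) \<in> \<rho>)"

text \<open>
  Multiplication of congruence classes.  For classes of a congruence the union is over equal sets,
  see \<open>quotient_mult_class\<close> below.
\<close>

definition quotient_mult ::
  "('a \<times> 'a) set \<Rightarrow> ('a \<Rightarrow> 'a \<Rightarrow> 'a) \<Rightarrow> 'a set \<Rightarrow> 'a set \<Rightarrow> 'a set" where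
  "quotient_mult \<rho> f A B = (\<Union>a\<in>A. \<Union>b\<in>B. \<rho> `` {f a b})"

lemma quotient_mult_class:
  assumes "congruence_on S f \<rho>" "a \<in> S" "b \<in> S"
  shows "quotient_mult \<rho> f (\<rho> `` {a}) (\<rho> `` {b}) = \<rho> `` {f a b}"
proof -
  have eq: "equiv S \<rho>"
    using assms(1) by (simp add: congruence_on_def)
  have comp: "(f c a, f c b) \<in> \<rho> \<and> (f a c, f b c) \<in> \<rho>"
    if "(a, b) \<in> \<rho>" "c \<in> S" for a b c
    using assms(1) that by (simp add: congruence_on_def)
  have "congruent2 \<rho> \<rho> (\<lambda>a b. \<rho> `` {f a b})"
  proof (rule congruent2I[OF eq eq])
    show "\<rho> `` {f y w} = \<rho> `` {f z w}" if "w \<in> S" "(y, z) \<in> \<rho>" for y z w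
      using comp[OF that(2,1)] by (intro equiv_class_eq[OF eq]) simp
    show "\<rho> `` {f w y} = \<rho> `` {f w z}" if "w \<in> S" "(y, z) \<in> \<rho>" for y z w
      using comp[OF that(2,1)] by (intro equiv_class_eq[OF eq]) simp
  qed
  then show ?thesis
    unfolding quotient_mult_def by (rule UN_equiv_class2[OF eq eq _ assms(2,3)])
qed

definition orthodox_congruence ::
  "'a set \<Rightarrow> ('a \<Rightarrow> 'a \<Rightarrow> 'a) \<Rightarrow> ('a \<times> 'a) set \<Rightarrow> bool" where
  "orthodox_congruence S f \<rho> \<longleftrightarrow>
     congruence_on S f \<rho> \<and> orthodox_semigroup (S // \<rho>) (quotient_mult \<rho> f)"

definition idempotent_separating ::
  "'a set \<Rightarrow> ('a \<Rightarrow> 'a \<Rightarrow> 'a) \<Rightarrow> ('a \<times> 'a) set \<Rightarrow> bool" where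
  "idempotent_separating S f \<rho> \<longleftrightarrow>
     (\<forall>d\<in>idempotents S f. \<forall>e\<in>idempotents S f. (d, e) \<in> \<rho> \<longrightarrow> d = e)"

definition greatest_idempotent_separating_congruence ::
  "'a set \<Rightarrow> ('a \<Rightarrow> 'a \<Rightarrow> 'a) \<Rightarrow> ('a \<times> 'a) set \<Rightarrow> bool" where
  "greatest_idempotent_separating_congruence S f \<mu> \<longleftrightarrow>
     congruence_on S f \<mu> \<and> idempotent_separating S f \<mu> \<and>
     (\<forall>\<rho>. congruence_on S f \<rho> \<and> idempotent_separating S f \<rho> \<longrightarrow> \<rho> \<subseteq> \<mu>)"

definition congruence_kernel ::
  "'a set \<Rightarrow> ('a \<Rightarrow> 'a \<Rightarrow> 'a) \<Rightarrow> ('a \<times> 'a) set \<Rightarrow> 'a set" where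
  "congruence_kernel S f \<rho> = {a \<in> S. \<exists>e\<in>idempotents S f. (a, e) \<in> \<rho>}"

text \<open>
  Green's relations of the semigroup \<open>S\<close> itself: two elements are related if they generate the
  same principal left (right) ideal, where the adjoined identity of \<open>S\<^sup>1\<close> contributes the
  generator.
\<close>

definition principal_left_ideal :: "'a set \<Rightarrow> ('a \<Rightarrow> 'a \<Rightarrow> 'a) \<Rightarrow> 'a \<Rightarrow> 'a set" where
  "principal_left_ideal S f a = insert a {f x a |x. x \<in> S}"

definition principal_right_ideal :: "'a set \<Rightarrow> ('a \<Rightarrow> 'a \<Rightarrow> 'a) \<Rightarrow> 'a \<Rightarrow> 'a set" where
  "principal_right_ideal S f a = insert a {f a x |x. x \<in> S}"

definition green_L :: "'a set \<Rightarrow> ('a \<Rightarrow> 'a \<Rightarrow> 'a) \<Rightarrow> ('a \<times> 'a) set" where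
  "green_L S f =
     {(a, b). a \<in> S \<and> b \<in> S \<and> principal_left_ideal S f a = principal_left_ideal S f b}"

definition green_R :: "'a set \<Rightarrow> ('a \<Rightarrow> 'a \<Rightarrow> 'a) \<Rightarrow> ('a \<times> 'a) set" where
  "green_R S f =
     {(a, b). a \<in> S \<and> b \<in> S \<and> principal_right_ideal S f a = principal_right_ideal S f b}"

definition green_H :: "'a set \<Rightarrow> ('a \<Rightarrow> 'a \<Rightarrow> 'a) \<Rightarrow> ('a \<times> 'a) set" where
  "green_H S f = green_L S f \<inter> green_R S f"

definition cryptic :: "'a set \<Rightarrow> ('a \<Rightarrow> 'a \<Rightarrow> 'a) \<Rightarrow> bool" where
  "cryptic S f \<longleftrightarrow> semigroup_on S f \<and> congruence_on S f (green_H S f)"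

end

theory Submission
  imports Defs
begin

text \<open>
  An element of \<open>ker \<mu>\<close> is \<open>\<mu>\<close>-related to the identity of the subgroup containing it, and
  \<open>\<H>\<close>-related elements of a completely regular semigroup are those with the same such identity.
  As \<open>\<mu>\<close> separates idempotents, Green's relation \<open>\<H>\<close> of \<open>ker \<mu>\<close> is therefore just the
  restriction of \<open>\<mu>\<close>, which is a congruence; orthodoxy makes \<open>ker \<mu>\<close> a subsemigroup.
\<close>

definition group_inverse_in ::
  "'a set \<Rightarrow> ('a \<Rightarrow> 'a \<Rightarrow> 'a) \<Rightarrow> 'a \<Rightarrow> 'a \<Rightarrow> 'a \<Rightarrow> bool" where
  "group_inverse_in S f a e x \<longleftrightarrow>
     a \<in> S \<and> e \<in> S \<and> x \<in> S \<and> f e e = e \<and> f e a = a \<and> f a e = a \<and>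
     f e x = x \<and> f x e = x \<and> f x a = e \<and> f a x = e"

lemma completely_regular_group_inverse:
  assumes "completely_regular S f" "a \<in> S"
  obtains e x where "group_inverse_in S f a e x"
proof -
  obtain G where G: "subgroup_of G S f" "a \<in> G"
    using assms unfolding completely_regular_def by blast
  then obtain e where sub: "G \<subseteq> S"
    and grp: "Group.group \<lparr>carrier = G, monoid.mult = f, one = e\<rparr>" (is "Group.group ?G")
    unfolding subgroup_of_def by blast
  interpret Group.group ?G by (rule grp)
  have "e \<in> G" "f e a = a" "f a e = a" "f e e = e"
    using one_closed l_one[of a] r_one[of a] l_one[of e] G(2) by simp_all
  moreover have "inv\<^bsub>?G\<^esub> a \<in> G" "f (inv\<^bsub>?G\<^esub> a) a = e" "f a (inv\<^bsub>?G\<^esub> a) = e"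
    "f e (inv\<^bsub>?G\<^esub> a) = inv\<^bsub>?G\<^esub> a" "f (inv\<^bsub>?G\<^esub> a) e = inv\<^bsub>?G\<^esub> a"
    using l_one[of "inv\<^bsub>?G\<^esub> a"] r_one[of "inv\<^bsub>?G\<^esub> a"]
      inv_closed[of a] l_inv[of a] r_inv[of a] G(2) by simp_all
  ultimately show ?thesis
    using that sub G(2) unfolding group_inverse_in_def by blast
qed

lemma green_L_iff_units:
  assumes K: "semigroup_on K f"
    and a: "group_inverse_in K f a e x" and b: "group_inverse_in K f b d y"
  shows "(a, b) \<in> green_L K f \<longleftrightarrow> f e d = e \<and> f d e = d"
proof -
  have assoc: "f (f p q) r = f p (f q r)" if "p \<in> K" "q \<in> K" "r \<in> K" for p q r
    using K that by (simp add: semigroup_on_def)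
  have closed: "f p q \<in> K" if "p \<in> K" "q \<in> K" for p q
    using K that by (simp add: semigroup_on_def)
  note A = a[unfolded group_inverse_in_def] and B = b[unfolded group_inverse_in_def]
  have fixed: "f e' d' = e'"
    if p: "group_inverse_in K f p e' u" and q: "group_inverse_in K f q d' v"
      and mem: "p \<in> principal_left_ideal K f q" for p q e' d' u v
  proof -
    note P = p[unfolded group_inverse_in_def] and Q = q[unfolded group_inverse_in_def]
    have "f p d' = p"
      using mem Q assoc unfolding principal_left_ideal_def by auto
    then show ?thesis
      using P Q assoc[of u p d'] by simp
  qed
  have sub: "principal_left_ideal K f p \<subseteq> principal_left_ideal K f q"
    if p: "group_inverse_in K f p e' u" and q: "group_inverse_in K f q d' v"
      and fix_unit: "f e' d' = e'" for p q e' d' u v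
  proof -
    note P = p[unfolded group_inverse_in_def] and Q = q[unfolded group_inverse_in_def]
    have p_eq: "f (f p v) q = p"
      using P Q fix_unit assoc[of p v q] assoc[of p e' d'] by simp
    have "f z p = f (f z (f p v)) q" if "z \<in> K" for z
      using that P Q closed p_eq assoc[of z "f p v" q] by simp
    moreover have "f p v \<in> K" "f z (f p v) \<in> K" if "z \<in> K" for z
      using that P Q closed by simp_all
    ultimately show ?thesis
      using P p_eq[symmetric] unfolding principal_left_ideal_def by blast
  qed
  show ?thesis
  proof
    assume "(a, b) \<in> green_L K f"
    then have eq: "principal_left_ideal K f a = principal_left_ideal K f b"
      by (simp add: green_L_def)
    have "a \<in> principal_left_ideal K f a" "b \<in> principal_left_ideal K f b"
      by (simp_all add: principal_left_ideal_def)
    then show "f e d = e \<and> f d e = d"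
      using fixed[OF a b] fixed[OF b a] eq by simp
  next
    assume "f e d = e \<and> f d e = d"
    then show "(a, b) \<in> green_L K f"
      using sub[OF a b] sub[OF b a] A B by (auto simp: green_L_def)
  qed
qed

lemma green_R_iff_units:
  assumes K: "semigroup_on K f"
    and a: "group_inverse_in K f a e x" and b: "group_inverse_in K f b d y"
  shows "(a, b) \<in> green_R K f \<longleftrightarrow> f d e = e \<and> f e d = d"
proof -
  let ?g = "\<lambda>p q. f q p"
  have "semigroup_on K ?g"
    using K by (simp add: semigroup_on_def)
  moreover have "group_inverse_in K ?g a e x" "group_inverse_in K ?g b d y"
    using a b by (auto simp: group_inverse_in_def)
  moreover have "green_R K f = green_L K ?g"
    by (simp add: green_R_def green_L_def principal_right_ideal_def principal_left_ideal_def)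
  ultimately show ?thesis
    using green_L_iff_units[of K ?g a e x b d y] by simp
qed

lemma green_H_iff_units:
  assumes "semigroup_on K f"
    and "group_inverse_in K f a e x" and "group_inverse_in K f b d y"
  shows "(a, b) \<in> green_H K f \<longleftrightarrow> e = d"
  using green_L_iff_units[OF assms] green_R_iff_units[OF assms] assms(2)
  unfolding green_H_def group_inverse_in_def by auto

lemma congruence_on_refl: "congruence_on S f \<rho> \<Longrightarrow> a \<in> S \<Longrightarrow> (a, a) \<in> \<rho>"
  unfolding congruence_on_def equiv_def refl_on_def by blast

lemma congruence_on_sym: "congruence_on S f \<rho> \<Longrightarrow> (a, b) \<in> \<rho> \<Longrightarrow> (b, a) \<in> \<rho>"
  unfolding congruence_on_def equiv_def sym_def by blast

lemma congruence_on_trans: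
  "congruence_on S f \<rho> \<Longrightarrow> (a, b) \<in> \<rho> \<Longrightarrow> (b, c) \<in> \<rho> \<Longrightarrow> (a, c) \<in> \<rho>"
  unfolding congruence_on_def equiv_def trans_def by blast

lemma congruence_on_mult:
  assumes "congruence_on S f \<rho>" "(a, b) \<in> \<rho>" "(c, d) \<in> \<rho>"
  shows "(f a c, f b d) \<in> \<rho>"
proof -
  have eq: "equiv S \<rho>" using assms(1) by (simp add: congruence_on_def)
  have "b \<in> S" "c \<in> S"
    using eq assms(2,3) by (auto dest: equiv_type)
  then have "(f a c, f b c) \<in> \<rho>" "(f b c, f b d) \<in> \<rho>"
    using assms by (auto simp: congruence_on_def)
  then show ?thesis
    using congruence_on_trans[OF assms(1)] by blast
qed

lemma congruence_on_restrict:
  assumes "congruence_on S f \<rho>" "semigroup_on K f" "K \<subseteq> S"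
  shows "congruence_on K f (\<rho> \<inter> K \<times> K)"
proof -
  have "equiv K (\<rho> \<inter> K \<times> K)"
    using assms(1,3) unfolding congruence_on_def equiv_def refl_on_def sym_def trans_def by blast
  then show ?thesis
    using assms unfolding congruence_on_def semigroup_on_def by blast
qed

lemma congruent_square_group_inverse:
  assumes cr: "completely_regular S f" and cong: "congruence_on S f \<rho>"
    and sq: "(a, f a a) \<in> \<rho>"
  obtains e x where "group_inverse_in S f a e x" "(a, e) \<in> \<rho>" "(x, e) \<in> \<rho>"
proof -
  have eq: "equiv S \<rho>" and S: "semigroup_on S f"
    using cr cong by (simp_all add: congruence_on_def completely_regular_def)
  note sym = congruence_on_sym[OF cong]
  have assoc: "f (f p q) r = f p (f q r)" if "p \<in> S" "q \<in> S" "r \<in> S" for p q r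
    using S that by (simp add: semigroup_on_def)
  have "a \<in> S" using eq sq by (auto dest: equiv_type)
  then obtain e x where ex: "group_inverse_in S f a e x"
    using completely_regular_group_inverse[OF cr] by blast
  note E = ex[unfolded group_inverse_in_def]
  have "(f x a, f x (f a a)) \<in> \<rho>"
    using cong sq E unfolding congruence_on_def by blast
  moreover have "f x (f a a) = a"
    using E assoc[of x a a] by simp
  ultimately have ae: "(a, e) \<in> \<rho>"
    using E sym by simp
  then have "(f x a, f x e) \<in> \<rho>"
    using cong E unfolding congruence_on_def by blast
  then have "(x, e) \<in> \<rho>"
    using E sym by simp
  with ex ae show ?thesis
    using that by blast
qed

lemma congruence_kernel_iff_square:
  assumes cr: "completely_regular S f" and cong: "congruence_on S f \<rho>"
  shows "a \<in> congruence_kernel S f \<rho> \<longleftrightarrow> (a, f a a) \<in> \<rho>"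
proof
  assume "a \<in> congruence_kernel S f \<rho>"
  then obtain e where "f e e = e" "(a, e) \<in> \<rho>"
    by (auto simp: congruence_kernel_def idempotents_def)
  then have "(e, f a a) \<in> \<rho>"
    using congruence_on_sym[OF cong] congruence_on_mult[OF cong, of a e a e] by simp
  with \<open>(a, e) \<in> \<rho>\<close> show "(a, f a a) \<in> \<rho>"
    by (rule congruence_on_trans[OF cong])
next
  assume "(a, f a a) \<in> \<rho>"
  then obtain e x where "group_inverse_in S f a e x" "(a, e) \<in> \<rho>"
    using congruent_square_group_inverse[OF cr cong] by blast
  then show "a \<in> congruence_kernel S f \<rho>"
    by (auto simp: congruence_kernel_def idempotents_def group_inverse_in_def)
qed

lemma congruence_kernel_group_inverse:
  assumes cr: "completely_regular S f" and cong: "congruence_on S f \<rho>"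
    and a: "a \<in> congruence_kernel S f \<rho>"
  obtains e x where "group_inverse_in (congruence_kernel S f \<rho>) f a e x" "(a, e) \<in> \<rho>"
proof -
  have "(a, f a a) \<in> \<rho>"
    using a congruence_kernel_iff_square[OF cr cong] by blast
  then obtain e x where ex: "group_inverse_in S f a e x" "(a, e) \<in> \<rho>" "(x, e) \<in> \<rho>"
    using congruent_square_group_inverse[OF cr cong] by blast
  have "(e, e) \<in> \<rho>"
    using ex congruence_on_refl[OF cong] by (simp add: group_inverse_in_def)
  then have "group_inverse_in (congruence_kernel S f \<rho>) f a e x"
    using ex by (auto simp: group_inverse_in_def congruence_kernel_def idempotents_def)
  then show ?thesis
    using that ex by blast
qed

lemma orthodox_congruence_kernel_closed:
  assumes cr: "completely_regular S f" and orth: "orthodox_congruence S f \<rho>"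
    and a: "a \<in> congruence_kernel S f \<rho>" and b: "b \<in> congruence_kernel S f \<rho>"
  shows "f a b \<in> congruence_kernel S f \<rho>"
proof -
  have cong: "congruence_on S f \<rho>"
    using orth by (simp add: orthodox_congruence_def)
  then have eq: "equiv S \<rho>"
    by (simp add: congruence_on_def)
  let ?m = "quotient_mult \<rho> f"
  have closed: "f p q \<in> S" if "p \<in> S" "q \<in> S" for p q
    using cr that by (simp add: completely_regular_def semigroup_on_def)
  have idem: "\<rho> `` {p} \<in> idempotents (S // \<rho>) ?m \<longleftrightarrow> p \<in> congruence_kernel S f \<rho>"
    if "p \<in> S" for p
    using that closed quotientI[of p S \<rho>] eq_equiv_class_iff[OF eq, of "f p p" p]
    by (auto simp: idempotents_def quotient_mult_class[OF cong]
        congruence_kernel_iff_square[OF cr cong] dest: congruence_on_sym[OF cong])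
  have S: "a \<in> S" "b \<in> S"
    using a b by (simp_all add: congruence_kernel_def)
  have "?m (\<rho> `` {a}) (\<rho> `` {b}) \<in> idempotents (S // \<rho>) ?m"
    using orth a b idem S by (simp add: orthodox_congruence_def orthodox_semigroup_def)
  then show ?thesis
    using idem S closed by (simp add: quotient_mult_class[OF cong])
qed

theorem corollary2p3:
  fixes S :: "'a set" and f :: "'a \<Rightarrow> 'a \<Rightarrow> 'a" and \<mu> :: "('a \<times> 'a) set"
  assumes "completely_regular S f"
    and "greatest_idempotent_separating_congruence S f \<mu>"
    and "orthodox_congruence S f \<mu>"
  shows "cryptic (congruence_kernel S f \<mu>) f"
proof -
  let ?K = "congruence_kernel S f \<mu>"
  have cong: "congruence_on S f \<mu>" and sep: "idempotent_separating S f \<mu>"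
    using assms(2) by (simp_all add: greatest_idempotent_separating_congruence_def)
  have KS: "?K \<subseteq> S"
    by (auto simp: congruence_kernel_def)
  have K: "semigroup_on ?K f"
    using assms(1) KS orthodox_congruence_kernel_closed[OF assms(1,3)]
    unfolding completely_regular_def semigroup_on_def by blast
  have iff: "(a, b) \<in> green_H ?K f \<longleftrightarrow> (a, b) \<in> \<mu>" if "a \<in> ?K" "b \<in> ?K" for a b
  proof -
    obtain e x where e: "group_inverse_in ?K f a e x" "(a, e) \<in> \<mu>"
      using congruence_kernel_group_inverse[OF assms(1) cong \<open>a \<in> ?K\<close>] .
    obtain d y where d: "group_inverse_in ?K f b d y" "(b, d) \<in> \<mu>"
      using congruence_kernel_group_inverse[OF assms(1) cong \<open>b \<in> ?K\<close>] .
    have idem: "e \<in> idempotents S f" "d \<in> idempotents S f"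
      using e(1) d(1) KS by (auto simp: group_inverse_in_def idempotents_def)
    have "(a, b) \<in> \<mu> \<longleftrightarrow> (e, d) \<in> \<mu>"
    proof
      assume "(a, b) \<in> \<mu>"
      then have "(a, d) \<in> \<mu>"
        using d(2) by (rule congruence_on_trans[OF cong])
      with congruence_on_sym[OF cong e(2)] show "(e, d) \<in> \<mu>"
        by (rule congruence_on_trans[OF cong])
    next
      assume "(e, d) \<in> \<mu>"
      with e(2) have "(a, d) \<in> \<mu>"
        by (rule congruence_on_trans[OF cong])
      then show "(a, b) \<in> \<mu>"
        using congruence_on_sym[OF cong d(2)] by (rule congruence_on_trans[OF cong])
    qed
    also have "\<dots> \<longleftrightarrow> e = d"
    proof
      assume "(e, d) \<in> \<mu>"
      then show "e = d"
        using sep idem unfolding idempotent_separating_def by blast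
    next
      assume "e = d"
      then show "(e, d) \<in> \<mu>"
        using congruence_on_refl[OF cong, of e] idem by (simp add: idempotents_def)
    qed
    finally show ?thesis
      using green_H_iff_units[OF K e(1) d(1)] by simp
  qed
  moreover have "green_H ?K f \<subseteq> ?K \<times> ?K"
    by (auto simp: green_H_def green_L_def)
  ultimately have "green_H ?K f = \<mu> \<inter> ?K \<times> ?K"
    by auto
  then show ?thesis
    using K congruence_on_restrict[OF cong K KS] by (simp add: cryptic_def)
qed

end
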